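(* Let $\mu$ be a positive finite Borel measure on $\mathbb{C}$, supported on an infinite set, with $0<\int_{\mathbb{C}}|z|^{2m}\,d\mu(z)<+\infty$ for all $m=0,1,2,\ldots$. Let $n\ge1$ be an integer. Then the $n$-point correlation measure increases monotonically with increasing $N$: for all integers $N\ge n$, $$\Gamma^{(n)}_{\mu,N}\le\Gamma^{(n)}_{\mu,N+1}$$ as measures on $\mathbb{C}^n$. Moreover, the total mass of $\Gamma^{(n)}_{\mu,N}$ equals $N!/(N-n)!$.
   Context: Let $\triangle(z_1,\ldots,z_N)=\prod_{1\le j<k\le N}(z_j-z_k)$ and $Z_N=\int_{\mathbb{C}^N}|\triangle(z_1,\ldots,z_N)|^2\,d\mu(z_1)\cdots d\mu(z_N)$. For $1\le n\le N$, the $n$-point correlation measure on $\mathbb{C}^n$ is $$d\Gamma^{(n)}_{\mu,N}(z_1,\ldots,z_n)=\frac{N!}{(N-n)!}\,\frac1{Z_N}\Big\{\int_{\mathbb{C}^{N-n}}|\triangle(z_1,\ldots,z_N)|^2\,d\mu(z_{n+1})\cdots d\mu(z_N)\Big\}\,d\mu(z_1)\cdots d\mu(z_n).$$ *)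

theory Defs
  imports "HOL-Analysis.Analysis"
begin

definition measure_support :: "'a::topological_space measure \<Rightarrow> 'a set" where
  "measure_support M = {x. \<forall>U. open U \<longrightarrow> x \<in> U \<longrightarrow> emeasure M U > 0}"

(* Points of C^N are functions on the index set {1..N}, the product measure
   d\<mu>(z_1) ... d\<mu>(z_N) is PiM {1..N} (\<lambda>_. \<mu>). *)

definition vandermonde :: "nat \<Rightarrow> (nat \<Rightarrow> complex) \<Rightarrow> complex" where
  "vandermonde N z = (\<Prod>j\<in>{1..N}. \<Prod>k\<in>{j<..N}. z j - z k)"

definition partition_fun :: "complex measure \<Rightarrow> nat \<Rightarrow> ennreal" where
  "partition_fun \<mu> N =
     (\<integral>\<^sup>+ z. ennreal ((cmod (vandermonde N z))\<^sup>2) \<partial>(\<Pi>\<^sub>M i\<in>{1..N}. \<mu>))"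

(* merge {1..n} {n+1..N} (z, w) is the point (z_1, ..., z_n, w_{n+1}, ..., w_N).
   For n = N the inner integral is over the one-point space, on which PiM {} is the
   unit mass.  All quantities are nonnegative, so the integrals and the quotient by Z_N
   are taken in ennreal. *)
definition correlation_measure ::
    "complex measure \<Rightarrow> nat \<Rightarrow> nat \<Rightarrow> (nat \<Rightarrow> complex) measure" where
  "correlation_measure \<mu> n N =
     density (\<Pi>\<^sub>M i\<in>{1..n}. \<mu>)
       (\<lambda>z. ennreal (fact N / fact (N - n)) * (1 / partition_fun \<mu> N) *
          (\<integral>\<^sup>+ w. ennreal ((cmod (vandermonde N (merge {1..n} {n+1..N} (z, w))))\<^sup>2)
             \<partial>(\<Pi>\<^sub>M i\<in>{n+1..N}. \<mu>)))"

lemma sets_correlation_measure [simp]: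
  "sets (correlation_measure \<mu> n N) = sets (\<Pi>\<^sub>M i\<in>{1..n}. \<mu>)"
  by (simp add: correlation_measure_def)

lemma space_correlation_measure [simp]:
  "space (correlation_measure \<mu> n N) = space (\<Pi>\<^sub>M i\<in>{1..n}. \<mu>)"
  by (simp add: correlation_measure_def)

(* The order on the type of measures also compares measures on different sigma-algebras;
   between correlation measures on the same C^n it is the setwise order. *)
lemma correlation_measure_le_iff:
  "correlation_measure \<mu> n N \<le> correlation_measure \<mu> n N' \<longleftrightarrow>
     (\<forall>A\<in>sets (\<Pi>\<^sub>M i\<in>{1..n}. \<mu>).
        emeasure (correlation_measure \<mu> n N) A \<le> emeasure (correlation_measure \<mu> n N') A)"
  by (subst le_measure) (auto simp: le_fun_def emeasure_notin_sets)

end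

theory Submission
  imports Defs
begin

text \<open>
  Let \<open>p\<^sub>0, \<dots>, p\<^sub>N\<close> be orthonormal polynomials for \<open>\<mu>\<close> with \<open>deg p\<^sub>k = k\<close>. Up to a constant factor, the
  modulus of the Vandermonde determinant in \<open>N\<close> variables is that of the Slater determinant
  \<open>det (p\<^sub>k(z\<^sub>j))\<close>, \<open>k < N\<close>. Integrating out the variables one at a time, by Laplace expansion and
  orthonormality, shows that the density of the \<open>n\<close>-point correlation measure is the sum, over all
  \<open>n\<close>-element subsets \<open>T\<close> of \<open>{0, \<dots>, N - 1}\<close>, of the squared moduli of the determinants
  \<open>det (p\<^sub>t(z\<^sub>j))\<close>, \<open>t\<close> in \<open>T\<close>. Passing to \<open>N + 1\<close> only adds nonnegative terms, and each term has
  integral \<open>n!\<close>.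
\<close>

section \<open>Slater determinants and their antisymmetry\<close>

text \<open>
  \<open>slater f m S z\<close> is, for \<open>card S = m\<close>, the determinant of the matrix with entries \<open>f s (z j)\<close>
  (\<open>s\<close> in \<open>S\<close>, \<open>1 \<le> j \<le> m\<close>), given by its Laplace expansion along the last variable, so that
  integrating out one variable becomes a single application of Parseval's identity.
\<close>

primrec slater :: "(nat \<Rightarrow> complex \<Rightarrow> complex) \<Rightarrow> nat \<Rightarrow> nat set \<Rightarrow> (nat \<Rightarrow> complex) \<Rightarrow> complex" where
  "slater f 0 S z = 1"
| "slater f (Suc m) S z =
     (\<Sum>s\<in>S. (-1) ^ card {t\<in>S. s < t} * f s (z (Suc m)) * slater f m (S - {s}) z)"

lemma slater_cong:
  assumes "\<And>i. 1 \<le> i \<Longrightarrow> i \<le> m \<Longrightarrow> z i = w i"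
  shows "slater f m S z = slater f m S w"
  using assms by (induction m arbitrary: S) auto

text \<open>Deleting the smaller index \<open>s\<close> leaves the number of elements above
  \<open>t\<close> unchanged, whereas deleting \<open>t\<close> lowers the number above
  \<open>s\<close> by one. This single step produces the sign.\<close>

lemma laplace_sign_swap_less:
  fixes S :: "nat set"
  assumes "finite S" "s \<in> S" "t \<in> S" "s < t"
  shows "(-1::complex) ^ card {u\<in>S. s < u} * (-1) ^ card {u\<in>S - {s}. t < u} =
    - ((-1) ^ card {u\<in>S. t < u} * (-1) ^ card {u\<in>S - {t}. s < u})"
proof -
  have "{u\<in>S. s < u} = insert t {u\<in>S - {t}. s < u}"
    using assms by auto
  then have "card {u\<in>S. s < u} = Suc (card {u\<in>S - {t}. s < u})"
    using assms(1) by simp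
  moreover have "{u\<in>S - {s}. t < u} = {u\<in>S. t < u}"
    using assms by auto
  ultimately show ?thesis by simp
qed

lemma laplace_sign_swap:
  fixes S :: "nat set"
  assumes "finite S" "s \<in> S" "t \<in> S" "s \<noteq> t"
  shows "(-1::complex) ^ card {u\<in>S. s < u} * (-1) ^ card {u\<in>S - {s}. t < u} =
    - ((-1) ^ card {u\<in>S. t < u} * (-1) ^ card {u\<in>S - {t}. s < u})"
  using laplace_sign_swap_less[OF assms(1,2,3)] laplace_sign_swap_less[OF assms(1,3,2)] assms(4)
  by (cases "s < t") auto

text \<open>Expanding along the last two variables gives a sum over ordered pairs of distinct
  indices. Exchanging the variables exchanges the roles of the two indices, and the product of the
  two Laplace signs is antisymmetric in them.\<close>

lemma slater_swap_last:
  assumes "finite S"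
  shows "slater f (Suc (Suc m)) S (z(Suc m := z (Suc (Suc m)), Suc (Suc m) := z (Suc m))) =
    - slater f (Suc (Suc m)) S z"
proof -
  define e where "e S s = (-1::complex) ^ card {t\<in>S. s < t}" for S :: "nat set" and s
  define a where "a = z (Suc m)"
  define b where "b = z (Suc (Suc m))"
  have sgn: "e S s * e (S - {s}) t = - (e S t * e (S - {t}) s)"
    if "s \<in> S" "t \<in> S" "s \<noteq> t" for s t
    unfolding e_def using assms that by (rule laplace_sign_swap)
  \<comment> \<open>\<open>G s t\<close> assigns \<open>s\<close> to the last variable and
    \<open>t\<close> to the one before it, so exchanging the variables turns \<open>G s t\<close>
    into \<open>G t s\<close>.\<close>
  define G where "G s t = f s b * f t a * slater f m (S - {s} - {t}) z" for s t
  have expand: "slater f (Suc (Suc m)) S z = (\<Sum>s\<in>S. \<Sum>t | t \<in> S \<and> s \<noteq> t. e S s * e (S - {s}) t * G s t)"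
  proof -
    have "S - {s} = {t. t \<in> S \<and> s \<noteq> t}" for s by auto
    then show ?thesis
      by (auto simp: e_def G_def a_def b_def sum_distrib_left mult_ac intro!: sum.cong)
  qed
  let ?z' = "z(Suc m := b, Suc (Suc m) := a)"
  have c: "slater f m T ?z' = slater f m T z" for T
    by (rule slater_cong) auto
  have "slater f (Suc (Suc m)) S ?z' =
     (\<Sum>s\<in>S. \<Sum>t | t \<in> S \<and> s \<noteq> t. e S s * e (S - {s}) t * G t s)"
  proof -
    have *: "S - {s} = {t. t \<in> S \<and> s \<noteq> t}" for s by auto
    have "slater f (Suc (Suc m)) S ?z' =
      (\<Sum>s\<in>S. \<Sum>t\<in>S - {s}. e S s * e (S - {s}) t * (f s a * f t b * slater f m (S - {s} - {t}) z))"
      using c by (simp add: e_def sum_distrib_left mult_ac)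
    also have "\<dots> = (\<Sum>s\<in>S. \<Sum>t\<in>S - {s}. e S s * e (S - {s}) t * G t s)"
      by (intro sum.cong refl) (simp add: G_def mult_ac Diff_insert2[symmetric] insert_commute)
    finally show ?thesis by (simp add: *)
  qed
  \<comment> \<open>Summing in the other order restores the arguments of \<open>G\<close> to the
    order of \<open>expand\<close>; the remaining discrepancy is the order of the two signs, settled
    by \<open>sgn\<close>.\<close>
  also have "\<dots> = (\<Sum>t\<in>S. \<Sum>s | s \<in> S \<and> s \<noteq> t. e S s * e (S - {s}) t * G t s)"
    by (rule sum.swap_restrict) (use assms in auto)
  also have "\<dots> = (\<Sum>t\<in>S. \<Sum>s | s \<in> S \<and> t \<noteq> s. - (e S t * e (S - {t}) s * G t s))"
  proof (intro sum.cong refl)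
    fix t s assume "t \<in> S" "s \<in> {s \<in> S. t \<noteq> s}"
    then have "e S s * e (S - {s}) t = - (e S t * e (S - {t}) s)"
      by (intro sgn) auto
    then show "e S s * e (S - {s}) t * G t s = - (e S t * e (S - {t}) s * G t s)"
      by simp
  qed auto
  finally show ?thesis
    unfolding expand by (simp add: sum_negf a_def b_def)
qed

text \<open>A swap that does not touch the last variable acts only on the minors of the Laplace
  expansion, so induction reduces to \<open>slater_swap_last\<close>.\<close>

lemma slater_swap_adjacent:
  assumes "finite S" "1 \<le> i" "i < m"
  shows "slater f m S (z(i := z (Suc i), Suc i := z i)) = - slater f m S z"
  using assms
proof (induction m arbitrary: S)
  case (Suc m)
  show ?case
  proof (cases "i = m")
    case True
    then obtain k where "m = Suc k" "i = Suc k"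
      using Suc.prems by (cases m) auto
    then show ?thesis using slater_swap_last[OF Suc.prems(1), of f k z] by (simp del: slater.simps fun_upd_apply)
  next
    case False
    then show ?thesis using Suc by (simp add: sum_negf)
  qed
qed simp

text \<open>Adjacent swaps bring the second of the two equal values next to the first. Swapping
  these two then changes nothing, so the determinant equals its own negative.\<close>

lemma slater_eq_0:
  assumes "finite S" "1 \<le> i" "i < j" "j \<le> m" "z i = z j"
  shows "slater f m S z = 0"
  using assms
proof (induction j arbitrary: z)
  case (Suc j)
  show ?case
  proof (cases "i = j")
    case True
    have "z(j := z (Suc j), Suc j := z j) = z"
      using Suc.prems True by auto
    then show ?thesis
      using slater_swap_adjacent[OF Suc.prems(1), of j m f z] Suc.prems True by simp
  next
    case False
    then have "slater f m S (z(j := z (Suc j), Suc j := z j)) = 0"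
      using Suc.prems by (intro Suc.IH) auto
    then show ?thesis
      using slater_swap_adjacent[OF Suc.prems(1), of j m f z] Suc.prems False by simp
  qed
qed simp

section \<open>The Vandermonde product as a Slater determinant of polynomials\<close>

text \<open>The difference of the two sides has degree below \<open>n\<close>, because the
  coefficients at \<open>n\<close> cancel, yet it vanishes at \<open>n\<close> points.\<close>

lemma poly_eq_smult_prod_roots:
  fixes p :: "'a::idom poly"
  assumes "degree p \<le> n" "card A = n" "finite A" "\<And>a. a \<in> A \<Longrightarrow> poly p a = 0"
  shows "p = smult (coeff p n) (\<Prod>a\<in>A. [:-a, 1:])"
proof (rule ccontr)
  let ?q = "p - smult (coeff p n) (\<Prod>a\<in>A. [:-a, 1:])"
  have d: "degree (\<Prod>a\<in>A. [:-a, 1:]) = n"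
    using assms by (simp add: degree_prod_eq_sum_degree)
  have l: "coeff (\<Prod>a\<in>A. [:-a, 1:]) n = 1"
    using lead_coeff_prod[of "\<lambda>a. [:-a, 1:]" A] d by simp
  assume "\<not> ?thesis"
  then have nz: "?q \<noteq> 0" by simp
  have "degree ?q \<le> n"
    using assms(1) d by (intro degree_diff_le) (auto intro: order_trans[OF degree_smult_le])
  moreover have "coeff ?q n = 0" using l by simp
  ultimately have "degree ?q < n"
    using nz by (metis eq_zero_or_degree_less)
  moreover have "A \<subseteq> {x. poly ?q x = 0}"
    using assms by (auto simp: poly_prod)
  then have "n \<le> card {x. poly ?q x = 0}"
    using assms(2) poly_roots_finite[OF nz] card_mono by blast
  ultimately show False
    using card_poly_roots_bound[OF nz] by simp
qed

text \<open>As a polynomial in the last variable, the determinant has degree at most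
  \<open>N\<close> and vanishes at \<open>z 1\<close>, ..., \<open>z N\<close>. Its coefficient at
  \<open>N\<close> comes from \<open>p N\<close> alone. If two of these points coincide, both sides
  are zero.\<close>

lemma slater_poly_Suc:
  assumes deg: "\<And>k. k \<le> N \<Longrightarrow> degree (p k) = k"
  shows "slater (\<lambda>k. poly (p k)) (Suc N) {..<Suc N} z =
    lead_coeff (p N) * slater (\<lambda>k. poly (p k)) N {..<N} z * (\<Prod>j\<in>{1..N}. z (Suc N) - z j)"
proof (cases "inj_on z {1..N}")
  case False
  then obtain i j where "i \<in> {1..N}" "j \<in> {1..N}" "z i = z j" "i \<noteq> j"
    by (auto simp: inj_on_def)
  then obtain i j where ij: "1 \<le> i" "i < j" "j \<le> N" "z i = z j"
    by (metis atLeastAtMost_iff nat_neq_iff)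
  show ?thesis
    using slater_eq_0[OF _ ij(1,2) _ ij(4), of "{..<N}" N] slater_eq_0[OF _ ij(1,2) _ ij(4), of "{..<Suc N}" "Suc N"] ij(3)
    by simp
next
  case True
  let ?f = "\<lambda>k. poly (p k)"
  \<comment> \<open>The \<open>c s\<close> are the signed minors of the expansion along the last
    variable; they do not involve that variable, so \<open>Q\<close> is the determinant as a
    polynomial in it.\<close>
  define c where "c s = (-1) ^ card {t\<in>{..<Suc N}. s < t} * slater ?f N ({..<Suc N} - {s}) z" for s
  define Q where "Q = (\<Sum>s<Suc N. smult (c s) (p s))"
  have Q: "poly Q x = slater ?f (Suc N) {..<Suc N} (z(Suc N := x))" for x
  proof -
    have "slater ?f N S (z(Suc N := x)) = slater ?f N S z" for S
      by (rule slater_cong) auto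
    then show ?thesis
      by (simp add: Q_def poly_sum c_def mult_ac)
  qed
  have "degree Q \<le> N"
    unfolding Q_def using deg
    by (intro degree_sum_le) (auto intro: order_trans[OF degree_smult_le])
  moreover have "poly Q a = 0" if "a \<in> z ` {1..N}" for a
  proof -
    from that obtain i where "i \<in> {1..N}" "a = z i" by auto
    then show ?thesis
      unfolding Q by (intro slater_eq_0[of _ i "Suc N"]) auto
  qed
  ultimately have "Q = smult (coeff Q N) (\<Prod>a\<in>z ` {1..N}. [:-a, 1:])"
    using True by (intro poly_eq_smult_prod_roots) (auto simp: card_image)
  then have "poly Q (z (Suc N)) = poly (smult (coeff Q N) (\<Prod>a\<in>z ` {1..N}. [:-a, 1:])) (z (Suc N))"
    by (rule arg_cong)
  also have "\<dots> = coeff Q N * (\<Prod>j\<in>{1..N}. z (Suc N) - z j)"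
    using True by (simp add: poly_prod prod.reindex)
  also have "coeff Q N = c N * coeff (p N) N"
  proof -
    have "coeff (p s) N = 0" if "s < N" for s
      using that deg[of s] by (simp add: coeff_eq_0)
    then show ?thesis by (simp add: Q_def coeff_sum)
  qed
  also have "c N = slater ?f N {..<N} z"
  proof -
    have "{t\<in>{..<Suc N}. N < t} = {}" "{..<Suc N} - {N} = {..<N}" by auto
    then show ?thesis unfolding c_def by (simp only: card.empty power_0 mult_1_left)
  qed
  finally show ?thesis
    using Q[of "z (Suc N)"] deg[of N] by (simp add: mult_ac)
qed

lemma vandermonde_Suc:
  "vandermonde (Suc N) z = vandermonde N z * (\<Prod>j\<in>{1..N}. z j - z (Suc N))"
proof -
  have "(\<Prod>k\<in>{j<..Suc N}. z j - z k) = (\<Prod>k\<in>{j<..N}. z j - z k) * (z j - z (Suc N))"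
    if "j \<in> {1..N}" for j
  proof -
    have "{j<..Suc N} = insert (Suc N) {j<..N}" using that by auto
    then show ?thesis by (simp add: mult.commute)
  qed
  then show ?thesis
    by (simp add: vandermonde_def prod.distrib)
qed

text \<open>\<open>slater_poly_Suc\<close> and \<open>vandermonde_Suc\<close> have the same
  recursive form up to the leading coefficient and the signs of the differences. Taking moduli
  discards those signs.\<close>

lemma cmod_slater_poly:
  assumes "\<And>k. k < N \<Longrightarrow> degree (p k) = k"
  shows "cmod (slater (\<lambda>k. poly (p k)) N {..<N} z) =
    (\<Prod>k<N. cmod (lead_coeff (p k))) * cmod (vandermonde N z)"
  using assms
proof (induction N)
  case 0
  then show ?case by (simp add: vandermonde_def)
next
  case (Suc N)
  have "slater (\<lambda>k. poly (p k)) (Suc N) {..<Suc N} z =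
    lead_coeff (p N) * slater (\<lambda>k. poly (p k)) N {..<N} z * (\<Prod>j\<in>{1..N}. z (Suc N) - z j)"
    using Suc.prems by (intro slater_poly_Suc) auto
  then show ?case
    using Suc by (simp add: vandermonde_Suc norm_mult prod_norm[symmetric] norm_minus_commute mult_ac del: slater.simps)
qed

section \<open>Orthonormal families and integrating out variables\<close>

lemma measurable_slater:
  assumes "\<And>s. s \<in> S \<Longrightarrow> f s \<in> borel_measurable M" "{1..m} \<subseteq> I"
  shows "slater f m S \<in> borel_measurable (\<Pi>\<^sub>M i\<in>I. M)"
  using assms
proof (induction m arbitrary: S)
  case 0
  have "slater f 0 S = (\<lambda>_. 1)" by (rule ext) simp
  then show ?case by simp
next
  case (Suc m)
  have "(\<lambda>z. f s (z (Suc m))) \<in> borel_measurable (\<Pi>\<^sub>M i\<in>I. M)" if "s \<in> S" for s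
    using Suc.prems that by (intro measurable_compose[OF measurable_component_singleton]) auto
  moreover have "slater f m (S - {s}) \<in> borel_measurable (\<Pi>\<^sub>M i\<in>I. M)" for s
    using Suc.prems by (intro Suc.IH) auto
  moreover have "slater f (Suc m) S = (\<lambda>z. \<Sum>s\<in>S.
      (-1) ^ card {t\<in>S. s < t} * f s (z (Suc m)) * slater f m (S - {s}) z)"
    by (rule ext) simp
  ultimately show ?case by simp
qed

text \<open>Integrability is demanded separately because the Bochner integral of a non-integrable
  function is 0, which would otherwise pass for orthogonality.\<close>

definition orthonormal_on :: "'a measure \<Rightarrow> nat set \<Rightarrow> (nat \<Rightarrow> 'a \<Rightarrow> complex) \<Rightarrow> bool" where
  "orthonormal_on M S f \<longleftrightarrow> (\<forall>s\<in>S. f s \<in> borel_measurable M) \<and>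
     (\<forall>s\<in>S. \<forall>t\<in>S. integrable M (\<lambda>x. f s x * cnj (f t x)) \<and>
        (\<integral>x. f s x * cnj (f t x) \<partial>M) = (if s = t then 1 else 0))"

lemma orthonormal_on_subset: "orthonormal_on M S f \<Longrightarrow> T \<subseteq> S \<Longrightarrow> orthonormal_on M T f"
  unfolding orthonormal_on_def by blast

text \<open>Expanding the square gives the double sum \<open>?h\<close>, of which orthonormality
  keeps the diagonal. The nonnegative integral on the left is the form in which iterated integrals
  over product measures produce it.\<close>

lemma parseval_orthonormal_on:
  assumes "orthonormal_on M S f" "finite S"
  shows "(\<integral>\<^sup>+x. ennreal ((cmod (\<Sum>s\<in>S. c s * f s x))\<^sup>2) \<partial>M) = ennreal (\<Sum>s\<in>S. (cmod (c s))\<^sup>2)"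
proof -
  let ?h = "\<lambda>x. \<Sum>s\<in>S. \<Sum>t\<in>S. c s * cnj (c t) * (f s x * cnj (f t x))"
  have i: "integrable M (\<lambda>x. f s x * cnj (f t x))" if "s \<in> S" "t \<in> S" for s t
    using assms that by (auto simp: orthonormal_on_def)
  have h: "(cmod (\<Sum>s\<in>S. c s * f s x))\<^sup>2 = Re (?h x)" for x
  proof -
    have "complex_of_real ((cmod (\<Sum>s\<in>S. c s * f s x))\<^sup>2) = ?h x"
      unfolding complex_norm_square by (simp add: sum_product mult_ac)
    then show ?thesis by (metis Re_complex_of_real)
  qed
  have ih: "integrable M ?h"
    using i by (intro Bochner_Integration.integrable_sum integrable_mult_right) auto
  have "(\<integral>x. ?h x \<partial>M) = (\<Sum>s\<in>S. \<Sum>t\<in>S. c s * cnj (c t) * (\<integral>x. f s x * cnj (f t x) \<partial>M))"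
    using i by (simp add: Bochner_Integration.integral_sum Bochner_Integration.integrable_sum)
  also have "\<dots> = (\<Sum>s\<in>S. \<Sum>t\<in>S. if s = t then c s * cnj (c s) else 0)"
    using assms(1) by (intro sum.cong refl) (auto simp: orthonormal_on_def)
  also have "\<dots> = (\<Sum>s\<in>S. complex_of_real ((cmod (c s))\<^sup>2))"
    using assms(2) by (simp add: complex_norm_square del: of_real_power)
  finally have "(\<integral>x. ?h x \<partial>M) = complex_of_real (\<Sum>s\<in>S. (cmod (c s))\<^sup>2)" by simp
  then have "(\<integral>x. Re (?h x) \<partial>M) = (\<Sum>s\<in>S. (cmod (c s))\<^sup>2)"
    using integral_Re[OF ih] by simp
  moreover have "integrable M (\<lambda>x. Re (?h x))"
    using ih by (rule integrable_Re)
  moreover have "AE x in M. 0 \<le> Re (?h x)"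
    unfolding h[symmetric] by simp
  ultimately show ?thesis
    unfolding h by (subst nn_integral_eq_integral) auto
qed

text \<open>In the last variable the determinant is a linear combination of the \<open>f s\<close>
  whose coefficients are minors up to sign, so Parseval's identity applies.\<close>

lemma nn_integral_slater_last:
  assumes "orthonormal_on M S f" "finite S"
  shows "(\<integral>\<^sup>+x. ennreal ((cmod (slater f (Suc m) S (z(Suc m := x))))\<^sup>2) \<partial>M) =
    (\<Sum>s\<in>S. ennreal ((cmod (slater f m (S - {s}) z))\<^sup>2))"
proof -
  let ?c = "\<lambda>s. (-1) ^ card {t\<in>S. s < t} * slater f m (S - {s}) z"
  have "slater f m T (z(Suc m := x)) = slater f m T z" for T x
    by (rule slater_cong) auto
  then have "slater f (Suc m) S (z(Suc m := x)) = (\<Sum>s\<in>S. ?c s * f s x)" for x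
    by (simp add: mult_ac)
  then show ?thesis
    using parseval_orthonormal_on[OF assms, of ?c] by (simp add: norm_mult norm_power del: slater.simps)
qed

text \<open>Double counting of the pairs of \<open>s\<close> and \<open>T\<close> with
  \<open>s\<close> outside \<open>T\<close>: each \<open>T\<close> is avoided by exactly
  \<open>d\<close> elements of \<open>S\<close>.\<close>

lemma sum_subsets_Diff_singleton:
  fixes g :: "'a set \<Rightarrow> 'b::semiring_1"
  assumes "finite S" "card S = n + d"
  shows "(\<Sum>s\<in>S. \<Sum>T | T \<subseteq> S - {s} \<and> card T = n. g T) =
    of_nat d * (\<Sum>T | T \<subseteq> S \<and> card T = n. g T)"
proof -
  let ?P = "{T. T \<subseteq> S \<and> card T = n}"
  have "{T. T \<subseteq> S - {s} \<and> card T = n} = {T \<in> ?P. s \<notin> T}" for s by auto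
  then have "(\<Sum>s\<in>S. \<Sum>T | T \<subseteq> S - {s} \<and> card T = n. g T) = (\<Sum>s\<in>S. \<Sum>T | T \<in> ?P \<and> s \<notin> T. g T)"
    by simp
  also have "\<dots> = (\<Sum>T\<in>?P. \<Sum>s | s \<in> S \<and> s \<notin> T. g T)"
    using assms(1) by (intro sum.swap_restrict) auto
  also have "\<dots> = (\<Sum>T\<in>?P. of_nat d * g T)"
  proof (intro sum.cong refl)
    fix T assume T: "T \<in> ?P"
    have "card {s \<in> S. s \<notin> T} = card (S - T)" by (rule arg_cong[where f = card]) auto
    also have "\<dots> = d"
      using T assms by (subst card_Diff_subset) (auto intro: finite_subset)
    finally show "(\<Sum>s | s \<in> S \<and> s \<notin> T. g T) = of_nat d * g T" by simp
  qed
  finally show ?thesis by (simp add: sum_distrib_left)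
qed

text \<open>Induction on \<open>d\<close>: integrating out the last variable deletes one index
  \<open>s\<close> in all possible ways. Each \<open>n\<close>-subset then arises from
  \<open>Suc d\<close> deletions, which turns \<open>fact d\<close> into
  \<open>fact (Suc d)\<close>.\<close>

lemma nn_integral_slater_merge:
  assumes "sigma_finite_measure M" "orthonormal_on M S f" "finite S" "card S = n + d"
    and z: "z \<in> space (\<Pi>\<^sub>M i\<in>{1..n}. M)"
  shows "(\<integral>\<^sup>+w. ennreal ((cmod (slater f (n + d) S (merge {1..n} {n+1..n+d} (z, w))))\<^sup>2)
      \<partial>(\<Pi>\<^sub>M i\<in>{n+1..n+d}. M)) =
    ennreal (fact d * (\<Sum>T | T \<subseteq> S \<and> card T = n. (cmod (slater f n T z))\<^sup>2))"
  using assms(2-4)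
proof (induction d arbitrary: S)
  case 0
  interpret product_sigma_finite "\<lambda>_. M" by (simp add: product_sigma_finite_def assms(1))
  have "{T. T \<subseteq> S \<and> card T = n} = {S}"
    using 0 card_subset_eq[of S] by auto
  moreover have "slater f n S (merge {1..n} {} (z, \<lambda>_. undefined)) = slater f n S z"
    by (rule slater_cong) (simp add: merge_def)
  ultimately show ?case by (simp add: nn_integral_empty)
next
  case (Suc d)
  interpret product_sigma_finite "\<lambda>_. M" by (simp add: product_sigma_finite_def assms(1))
  let ?I = "{n+1..n+d}" and ?k = "Suc (n + d)"
  let ?m = "\<lambda>w. merge {1..n} {n+1..n+d} (z, w)"
  have I: "{n+1..n+Suc d} = insert ?k ?I" by auto
  have fm: "f s \<in> borel_measurable M" if "s \<in> S" for s
    using Suc.prems(1) that by (auto simp: orthonormal_on_def)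
  have mm: "(\<lambda>w. merge {1..n} J (z, w)) \<in> measurable (\<Pi>\<^sub>M i\<in>J. M) (\<Pi>\<^sub>M i\<in>{1..n} \<union> J. M)" for J
    using z by measurable
  have meas: "(\<lambda>w. ennreal ((cmod (slater f ?k S (merge {1..n} (insert ?k ?I) (z, w))))\<^sup>2))
    \<in> borel_measurable (\<Pi>\<^sub>M i\<in>insert ?k ?I. M)"
    using fm by (intro measurable_compose[OF measurable_compose[OF mm measurable_slater]]) auto
  have meas': "(\<lambda>w. ennreal ((cmod (slater f (n + d) (S - {s}) (?m w)))\<^sup>2)) \<in> borel_measurable (\<Pi>\<^sub>M i\<in>?I. M)" for s
    using fm by (intro measurable_compose[OF measurable_compose[OF mm measurable_slater]]) auto
  have upd: "merge {1..n} (insert ?k ?I) (z, w(?k := y)) = (?m w)(?k := y)" for w y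
    by (auto simp: merge_def fun_eq_iff)
  have "(\<integral>\<^sup>+w. ennreal ((cmod (slater f ?k S (merge {1..n} (insert ?k ?I) (z, w))))\<^sup>2)
      \<partial>(\<Pi>\<^sub>M i\<in>insert ?k ?I. M)) =
    (\<integral>\<^sup>+w. (\<integral>\<^sup>+y. ennreal ((cmod (slater f ?k S ((?m w)(?k := y))))\<^sup>2) \<partial>M) \<partial>(\<Pi>\<^sub>M i\<in>?I. M))"
    using meas by (subst product_nn_integral_insert) (simp_all only: upd, auto)
  also have "\<dots> = (\<integral>\<^sup>+w. (\<Sum>s\<in>S. ennreal ((cmod (slater f (n + d) (S - {s}) (?m w)))\<^sup>2)) \<partial>(\<Pi>\<^sub>M i\<in>?I. M))"
    by (simp only: nn_integral_slater_last[OF Suc.prems(1,2)])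
  also have "\<dots> = (\<Sum>s\<in>S. \<integral>\<^sup>+w. ennreal ((cmod (slater f (n + d) (S - {s}) (?m w)))\<^sup>2) \<partial>(\<Pi>\<^sub>M i\<in>?I. M))"
    using meas' by (intro nn_integral_sum)
  also have "\<dots> = (\<Sum>s\<in>S. ennreal (fact d * (\<Sum>T | T \<subseteq> S - {s} \<and> card T = n. (cmod (slater f n T z))\<^sup>2)))"
    using Suc.prems by (intro sum.cong refl Suc.IH orthonormal_on_subset[OF Suc.prems(1)]) auto
  also have "\<dots> = ennreal (fact d * (\<Sum>s\<in>S. \<Sum>T | T \<subseteq> S - {s} \<and> card T = n. (cmod (slater f n T z))\<^sup>2))"
    by (subst sum_ennreal) (auto simp: sum_distrib_left intro!: mult_nonneg_nonneg sum_nonneg)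
  also have "fact d * (\<Sum>s\<in>S. \<Sum>T | T \<subseteq> S - {s} \<and> card T = n. (cmod (slater f n T z))\<^sup>2) =
      fact (Suc d) * (\<Sum>T | T \<subseteq> S \<and> card T = n. (cmod (slater f n T z))\<^sup>2)"
    unfolding sum_subsets_Diff_singleton[OF Suc.prems(2,3)] by (simp add: algebra_simps)
  finally show ?case
    unfolding I by simp
qed

text \<open>The case of \<open>nn_integral_slater_merge\<close> with no variable kept: the only
  \<open>T\<close> is empty, its determinant is 1, and the constant function
  \<open>undefined\<close> is the single point of the empty product.\<close>

lemma nn_integral_slater:
  assumes "sigma_finite_measure M" "orthonormal_on M S f" "finite S" "card S = n"
  shows "(\<integral>\<^sup>+w. ennreal ((cmod (slater f n S w))\<^sup>2) \<partial>(\<Pi>\<^sub>M i\<in>{1..n}. M)) = ennreal (fact n)"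
proof -
  have "slater f n S (merge {} {1..n} (\<lambda>_. undefined, w)) = slater f n S w" for w
    by (rule slater_cong) (simp add: merge_def)
  moreover have "{T. T \<subseteq> S \<and> card T = 0} = {{}}"
    using assms(3) by (auto dest: finite_subset)
  ultimately show ?thesis
    using nn_integral_slater_merge[OF assms(1-3), of 0 n "\<lambda>_. undefined"] assms(4)
    by (simp add: space_PiM)
qed

section \<open>Existence of orthonormal polynomials\<close>

text \<open>By linearity it suffices to treat the products of a power of \<open>z\<close> and a
  power of \<open>cnj z\<close>. These are dominated by 1 plus an even moment, and constants are
  integrable for a finite measure.\<close>

lemma integrable_poly_mult_cnj:
  fixes \<mu> :: "complex measure"
  assumes sets: "sets \<mu> = sets borel" and fin: "finite_measure \<mu>"
    and mom: "\<And>m::nat. (\<integral>\<^sup>+ z. ennreal (cmod z ^ (2 * m)) \<partial>\<mu>) < \<infinity>"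
  shows "integrable \<mu> (\<lambda>z. poly p z * cnj (poly q z))"
proof -
  interpret finite_measure \<mu> by fact
  note [measurable_cong] = sets
  have even: "integrable \<mu> (\<lambda>z. cmod z ^ (2 * m))" for m
    using mom[of m] by (intro integrableI_bounded) auto
  have mono: "integrable \<mu> (\<lambda>z. z ^ i * cnj z ^ j)" for i j
  proof (rule Bochner_Integration.integrable_bound)
    show "integrable \<mu> (\<lambda>z. 1 + cmod z ^ (2 * (i + j)))"
      by (intro Bochner_Integration.integrable_add even) simp
    have bound: "x ^ k \<le> 1 + x ^ (2 * k)" if "0 \<le> x" for x :: real and k
    proof -
      \<comment> \<open>Expanded, this is \<open>x ^ (2 * k) - x ^ k + 1\<close>.\<close>
      have "0 \<le> (x ^ k - 1)\<^sup>2 + x ^ k" using that by simp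
      then show ?thesis by (simp add: power2_diff power_mult[symmetric] mult.commute)
    qed
    show "AE z in \<mu>. norm (z ^ i * cnj z ^ j) \<le> norm (1 + cmod z ^ (2 * (i + j)))"
    proof (rule AE_I2)
      fix z
      show "norm (z ^ i * cnj z ^ j) \<le> norm (1 + cmod z ^ (2 * (i + j)))"
        using bound[of "cmod z" "i + j"] by (simp add: norm_mult norm_power power_add[symmetric])
    qed
    have "continuous_on UNIV (\<lambda>z. z ^ i * cnj z ^ j)" by (intro continuous_intros)
    then show "(\<lambda>z. z ^ i * cnj z ^ j) \<in> borel_measurable \<mu>"
      using borel_measurable_continuous_onI measurable_cong_sets[OF sets refl] by blast
  qed
  have "poly p z * cnj (poly q z) =
    (\<Sum>i\<le>degree p. \<Sum>j\<le>degree q. coeff p i * cnj (coeff q j) * (z ^ i * cnj z ^ j))" for z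
    by (simp add: poly_altdef sum_product mult_ac)
  then show ?thesis
    using mono by (simp add: Bochner_Integration.integrable_sum)
qed

text \<open>If the integral were zero, the open set where \<open>p\<close> does not vanish would be
  null. The support would then lie in the finite root set of \<open>p\<close>.\<close>

lemma integral_cmod_poly_pos:
  fixes \<mu> :: "complex measure"
  assumes sets: "sets \<mu> = sets borel" and supp: "infinite (measure_support \<mu>)"
    and int: "integrable \<mu> (\<lambda>z. (cmod (poly p z))\<^sup>2)" and "p \<noteq> 0"
  shows "0 < (\<integral>z. (cmod (poly p z))\<^sup>2 \<partial>\<mu>)"
proof (rule ccontr)
  assume "\<not> ?thesis"
  then have "(\<integral>z. (cmod (poly p z))\<^sup>2 \<partial>\<mu>) = 0"
    by (simp add: order_antisym not_less)
  then have ae: "AE z in \<mu>. poly p z = 0"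
    using int by (subst (asm) integral_nonneg_eq_0_iff_AE) auto
  let ?U = "{z. poly p z \<noteq> 0}"
  have op: "open ?U"
    by (intro open_Collect_neq continuous_intros)
  have "?U \<in> sets \<mu>" using op sets by simp
  moreover have "{z \<in> space \<mu>. \<not> poly p z = 0} = ?U"
    using sets_eq_imp_space_eq[OF sets] by simp
  ultimately have "emeasure \<mu> ?U = 0"
    using ae by (simp only: AE_iff_measurable[of ?U \<mu> "\<lambda>z. poly p z = 0"])
  then have "measure_support \<mu> \<subseteq> {z. poly p z = 0}"
    using op unfolding measure_support_def by auto
  then show False
    using supp poly_roots_finite[OF \<open>p \<noteq> 0\<close>] finite_subset by blast
qed

text \<open>Gram-Schmidt applied to the monomials. The infinite support ensures that no step yields
  a polynomial of norm zero.\<close>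

lemma orthonormal_polynomials_exist:
  fixes \<mu> :: "complex measure"
  assumes sets: "sets \<mu> = sets borel" and fin: "finite_measure \<mu>"
    and supp: "infinite (measure_support \<mu>)"
    and mom: "\<And>m::nat. (\<integral>\<^sup>+ z. ennreal (cmod z ^ (2 * m)) \<partial>\<mu>) < \<infinity>"
  shows "\<exists>p. (\<forall>k<N. degree (p k) = k) \<and> orthonormal_on \<mu> {..<N} (\<lambda>k. poly (p k))"
proof (induction N)
  case 0
  show ?case by (auto simp: orthonormal_on_def)
next
  case (Suc N)
  then obtain p where p: "\<And>k. k < N \<Longrightarrow> degree (p k) = k" "orthonormal_on \<mu> {..<N} (\<lambda>k. poly (p k))"
    by auto
  define ip where "ip p q = (\<integral>z. poly p z * cnj (poly q z) \<partial>\<mu>)" for p q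
  note int = integrable_poly_mult_cnj[OF sets fin mom]
  have pp: "ip (p s) (p t) = (if s = t then 1 else 0)" if "s < N" "t < N" for s t
    using p(2) that by (auto simp: orthonormal_on_def ip_def)
  have ip_cnj: "ip q p = cnj (ip p q)" for p q
    using Bochner_Integration.integral_cnj[of \<mu> "\<lambda>z. poly p z * cnj (poly q z)"]
    by (simp add: ip_def mult.commute)
  have ip_diff: "ip (a - b) q = ip a q - ip b q" for a b q
    unfolding ip_def using int by (simp add: left_diff_distrib Bochner_Integration.integral_diff)
  have ip_smult: "ip (smult c a) q = c * ip a q" for c a q
    unfolding ip_def by (simp add: mult.assoc)
  have ip_sum: "ip (\<Sum>k\<in>A. g k) q = (\<Sum>k\<in>A. ip (g k) q)" for A q and g :: "nat \<Rightarrow> complex poly"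
    unfolding ip_def using int
    by (simp add: poly_sum sum_distrib_right Bochner_Integration.integral_sum)
  \<comment> \<open>The monomial minus its projection onto the earlier polynomials. These have
    degree below \<open>N\<close>, so \<open>q\<close> is monic of degree \<open>N\<close>.\<close>
  define q where "q = monom 1 N - (\<Sum>k<N. smult (ip (monom 1 N) (p k)) (p k))"
  have qorth: "ip q (p t) = 0" if "t < N" for t
  proof -
    have "(\<Sum>k<N. ip (monom 1 N) (p k) * ip (p k) (p t)) = (\<Sum>k<N. if k = t then ip (monom 1 N) (p k) else 0)"
      using that pp by (intro sum.cong) auto
    then show ?thesis
      using that by (simp add: q_def ip_diff ip_sum ip_smult)
  qed
  have "degree (\<Sum>k<N. smult (ip (monom 1 N) (p k)) (p k)) \<le> N"
    using p(1) by (intro degree_sum_le) (auto intro: order_trans[OF degree_smult_le])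
  then have "degree q \<le> N"
    unfolding q_def by (intro degree_diff_le) (auto simp: degree_monom_le)
  moreover have qN: "coeff q N = 1"
  proof -
    have "coeff (p k) N = 0" if "k < N" for k
      using that p(1)[of k] by (simp add: coeff_eq_0)
    then show ?thesis by (simp add: q_def coeff_sum)
  qed
  ultimately have degq: "degree q = N"
    using le_degree[of q N] by simp
  have "q \<noteq> 0" using qN by auto
  define r where "r = (\<integral>z. (cmod (poly q z))\<^sup>2 \<partial>\<mu>)"
  have sq: "complex_of_real ((cmod (poly q z))\<^sup>2) = poly q z * cnj (poly q z)" for z
    by (rule complex_norm_square)
  have "integrable \<mu> (\<lambda>z. complex_of_real ((cmod (poly q z))\<^sup>2))"
    unfolding sq by (rule int)
  then have "integrable \<mu> (\<lambda>z. (cmod (poly q z))\<^sup>2)"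
    by (simp only: complex_of_real_integrable_eq)
  then have r: "0 < r"
    unfolding r_def using \<open>q \<noteq> 0\<close> by (intro integral_cmod_poly_pos sets supp)
  have ipq: "ip q q = complex_of_real r"
    unfolding ip_def sq[symmetric] r_def by (rule integral_complex_of_real)
  define e where "e = smult (1 / complex_of_real (sqrt r)) q"
  have e_orth: "ip e (p t) = 0" "ip (p t) e = 0" if "t < N" for t
    using qorth[OF that] ip_cnj[of "p t" e] by (simp_all add: e_def ip_smult)
  have "ip e e = cnj (1 / complex_of_real (sqrt r)) * (1 / complex_of_real (sqrt r)) * complex_of_real r"
    unfolding e_def ip_smult by (subst ip_cnj) (simp add: ip_smult ipq)
  also have "\<dots> = 1"
    using r by (simp flip: of_real_mult of_real_divide)
  finally have e1: "ip e e = 1" .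
  have dege: "degree e = N"
    using r degq by (simp add: e_def)
  let ?p = "p(N := e)"
  have "ip (?p s) (?p t) = (if s = t then 1 else 0)" if "s < Suc N" "t < Suc N" for s t
    using that pp e_orth e1 by (auto simp: less_Suc_eq)
  moreover have "poly (?p s) \<in> borel_measurable \<mu>" for s
  proof -
    have "continuous_on UNIV (poly (?p s))" by (intro continuous_intros)
    then show ?thesis
      using borel_measurable_continuous_onI measurable_cong_sets[OF sets refl] by blast
  qed
  ultimately have "orthonormal_on \<mu> {..<Suc N} (\<lambda>k. poly (?p k))"
    using int by (auto simp: orthonormal_on_def ip_def)
  moreover have "\<forall>k<Suc N. degree (?p k) = k"
    using p(1) dege by (auto simp: less_Suc_eq)
  ultimately show ?case by blast
qed

section \<open>The correlation density and the comparison of consecutive \<open>N\<close>\<close>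

lemma prod_lead_coeff_pos:
  assumes "orthonormal_on M {..<N} (\<lambda>k. poly (p k))"
  shows "0 < (\<Prod>k<N. cmod (lead_coeff (p k)))"
proof (rule prod_pos)
  fix k assume "k \<in> {..<N}"
  then have "(\<integral>z. poly (p k) z * cnj (poly (p k) z) \<partial>M) = 1"
    using assms by (simp add: orthonormal_on_def)
  then have "p k \<noteq> 0" by auto
  then show "0 < cmod (lead_coeff (p k))" by simp
qed

text \<open>Replacing the Vandermonde product by the Slater determinant costs a factor
  \<open>1 / L\<^sup>2\<close> in both the partition function and the inner integral. It cancels, as
  do the factorials \<open>fact N\<close> and \<open>fact (N - n)\<close> arising from the two
  integrations.\<close>

lemma correlation_measure_eq_density:
  assumes sf: "sigma_finite_measure \<mu>" and on: "orthonormal_on \<mu> {..<N} (\<lambda>k. poly (p k))"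
    and deg: "\<And>k. k < N \<Longrightarrow> degree (p k) = k" and "n \<le> N"
  shows "correlation_measure \<mu> n N = density (\<Pi>\<^sub>M i\<in>{1..n}. \<mu>)
    (\<lambda>z. \<Sum>T | T \<subseteq> {..<N} \<and> card T = n. ennreal ((cmod (slater (\<lambda>k. poly (p k)) n T z))\<^sup>2))"
proof -
  let ?f = "\<lambda>k. poly (p k)"
  define L where "L = (\<Prod>k<N. cmod (lead_coeff (p k)))"
  have L: "0 < L" unfolding L_def by (rule prod_lead_coeff_pos[OF on])
  obtain d where N: "N = n + d" using \<open>n \<le> N\<close> le_Suc_ex by blast
  have vdm: "ennreal ((cmod (vandermonde N z))\<^sup>2) =
      ennreal (1 / L\<^sup>2) * ennreal ((cmod (slater ?f N {..<N} z))\<^sup>2)" for z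
  proof -
    have "cmod (slater ?f N {..<N} z) = L * cmod (vandermonde N z)"
      unfolding L_def using deg by (rule cmod_slater_poly)
    then show ?thesis
      using L by (simp add: ennreal_mult[symmetric] power_mult_distrib)
  qed
  have fm: "?f s \<in> borel_measurable \<mu>" if "s \<in> {..<N}" for s
    using on that by (auto simp: orthonormal_on_def)
  have Z: "partition_fun \<mu> N = ennreal (fact N / L\<^sup>2)"
  proof -
    have "(\<lambda>z. ennreal ((cmod (slater ?f N {..<N} z))\<^sup>2)) \<in> borel_measurable (\<Pi>\<^sub>M i\<in>{1..N}. \<mu>)"
      using fm by (intro measurable_compose[OF measurable_slater]) auto
    moreover have "(\<integral>\<^sup>+z. ennreal ((cmod (slater ?f N {..<N} z))\<^sup>2) \<partial>(\<Pi>\<^sub>M i\<in>{1..N}. \<mu>)) = ennreal (fact N)"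
      by (rule nn_integral_slater[OF sf on]) simp_all
    ultimately show ?thesis
      unfolding partition_fun_def vdm by (simp only: nn_integral_cmult) (simp flip: ennreal_mult)
  qed
  have "ennreal (fact N / fact (N - n)) * (1 / partition_fun \<mu> N) *
      (\<integral>\<^sup>+ w. ennreal ((cmod (vandermonde N (merge {1..n} {n+1..N} (z, w))))\<^sup>2) \<partial>(\<Pi>\<^sub>M i\<in>{n+1..N}. \<mu>)) =
    (\<Sum>T | T \<subseteq> {..<N} \<and> card T = n. ennreal ((cmod (slater ?f n T z))\<^sup>2))"
    if z: "z \<in> space (\<Pi>\<^sub>M i\<in>{1..n}. \<mu>)" for z
  proof -
    let ?\<Sigma> = "\<Sum>T | T \<subseteq> {..<N} \<and> card T = n. (cmod (slater ?f n T z))\<^sup>2"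
    have "(\<lambda>w. merge {1..n} {n+1..N} (z, w)) \<in> measurable (\<Pi>\<^sub>M i\<in>{n+1..N}. \<mu>) (\<Pi>\<^sub>M i\<in>{1..n} \<union> {n+1..N}. \<mu>)"
      using z by measurable
    then have "(\<lambda>w. ennreal ((cmod (slater ?f N {..<N} (merge {1..n} {n+1..N} (z, w))))\<^sup>2))
        \<in> borel_measurable (\<Pi>\<^sub>M i\<in>{n+1..N}. \<mu>)"
      using fm by (intro measurable_compose[OF measurable_compose[OF _ measurable_slater]]) auto
    then have "(\<integral>\<^sup>+ w. ennreal ((cmod (vandermonde N (merge {1..n} {n+1..N} (z, w))))\<^sup>2) \<partial>(\<Pi>\<^sub>M i\<in>{n+1..N}. \<mu>)) =
        ennreal (1 / L\<^sup>2) * ennreal (fact d * ?\<Sigma>)"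
      unfolding vdm using nn_integral_slater_merge[OF sf on _ _ z, of d] N
      by (subst nn_integral_cmult) simp_all
    moreover have "1 / partition_fun \<mu> N = ennreal (L\<^sup>2 / fact N)"
      unfolding Z using L by (simp add: divide_ennreal flip: ennreal_1)
    moreover have "0 \<le> ?\<Sigma>" by (simp add: sum_nonneg)
    moreover have "fact N / fact (N - n) * (L\<^sup>2 / fact N) * (1 / L\<^sup>2 * (fact d * ?\<Sigma>)) = ?\<Sigma>"
      using L N by simp
    ultimately have "ennreal (fact N / fact (N - n)) * (1 / partition_fun \<mu> N) *
      (\<integral>\<^sup>+ w. ennreal ((cmod (vandermonde N (merge {1..n} {n+1..N} (z, w))))\<^sup>2) \<partial>(\<Pi>\<^sub>M i\<in>{n+1..N}. \<mu>)) = ennreal ?\<Sigma>"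
      by (simp flip: ennreal_mult)
    then show ?thesis by (simp add: sum_ennreal)
  qed
  \<comment> \<open>The densities are compared only on the space and under the integral that defines
    \<open>density\<close>, which avoids proving the inner integral measurable in
    \<open>z\<close>.\<close>
  then show ?thesis
    unfolding correlation_measure_def density_def
    by (intro arg_cong[where f = "measure_of _ _"] ext) (auto intro!: nn_integral_cong)
qed

theorem corollary2p3:
  fixes \<mu> :: "complex measure" and n :: nat
  assumes "sets \<mu> = sets borel"
    and "finite_measure \<mu>"
    and "infinite (measure_support \<mu>)"
    and "\<And>m::nat. 0 < (\<integral>\<^sup>+ z. ennreal (cmod z ^ (2 * m)) \<partial>\<mu>)"
    and "\<And>m::nat. (\<integral>\<^sup>+ z. ennreal (cmod z ^ (2 * m)) \<partial>\<mu>) < \<infinity>"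
    and "1 \<le> n"
  shows "(\<forall>N\<ge>n. correlation_measure \<mu> n N \<le> correlation_measure \<mu> n (N + 1)) \<and>
         (\<forall>N\<ge>n. emeasure (correlation_measure \<mu> n N) (space (correlation_measure \<mu> n N))
              = ennreal (fact N / fact (N - n)))"
proof (intro conjI allI impI)
  interpret finite_measure \<mu> by fact
  have sf: "sigma_finite_measure \<mu>" ..
  note ex = orthonormal_polynomials_exist[OF assms(1,2,3,5)]
  fix N assume "n \<le> N"
  \<comment> \<open>One family serves both measures: its first \<open>N\<close> members handle
    \<open>N\<close>, so the two densities can be compared term by term.\<close>
  obtain p where deg: "\<And>k. k < N + 1 \<Longrightarrow> degree (p k) = k"
    and on': "orthonormal_on \<mu> {..<N + 1} (\<lambda>k. poly (p k))"
    using ex[of "N + 1"] by blast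
  let ?f = "\<lambda>k. poly (p k)"
  have on: "orthonormal_on \<mu> {..<N} ?f"
    by (rule orthonormal_on_subset[OF on']) auto
  define \<rho> where "\<rho> K z = (\<Sum>T | T \<subseteq> {..<K} \<and> card T = n. ennreal ((cmod (slater ?f n T z))\<^sup>2))" for K z
  have meas: "(\<lambda>z. ennreal ((cmod (slater ?f n T z))\<^sup>2)) \<in> borel_measurable (\<Pi>\<^sub>M i\<in>{1..n}. \<mu>)"
    if "T \<subseteq> {..<N + 1}" for T
    using on' that by (intro measurable_compose[OF measurable_slater]) (auto simp: orthonormal_on_def)
  have \<rho>: "\<rho> K \<in> borel_measurable (\<Pi>\<^sub>M i\<in>{1..n}. \<mu>)" if "K \<le> N + 1" for K
    unfolding \<rho>_def using that by (intro borel_measurable_sum meas) auto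
  have c: "correlation_measure \<mu> n N = density (\<Pi>\<^sub>M i\<in>{1..n}. \<mu>) (\<rho> N)"
    unfolding \<rho>_def using \<open>n \<le> N\<close> deg by (intro correlation_measure_eq_density sf on) auto
  have c': "correlation_measure \<mu> n (N + 1) = density (\<Pi>\<^sub>M i\<in>{1..n}. \<mu>) (\<rho> (N + 1))"
    unfolding \<rho>_def using \<open>n \<le> N\<close> deg by (intro correlation_measure_eq_density sf on') auto
  have "\<rho> N z \<le> \<rho> (N + 1) z" for z
    unfolding \<rho>_def by (intro sum_mono2) (auto simp: less_Suc_eq)
  then show "correlation_measure \<mu> n N \<le> correlation_measure \<mu> n (N + 1)"
    unfolding correlation_measure_le_iff unfolding c c' using \<rho>
    by (auto simp: emeasure_density intro!: nn_integral_mono mult_right_mono)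
  have "emeasure (density (\<Pi>\<^sub>M i\<in>{1..n}. \<mu>) (\<rho> N)) (space (\<Pi>\<^sub>M i\<in>{1..n}. \<mu>)) =
      (\<integral>\<^sup>+z. \<rho> N z \<partial>(\<Pi>\<^sub>M i\<in>{1..n}. \<mu>))"
    using \<rho>[of N] by (subst emeasure_density) (auto intro!: nn_integral_cong)
  also have "\<dots> = (\<Sum>T | T \<subseteq> {..<N} \<and> card T = n.
      \<integral>\<^sup>+z. ennreal ((cmod (slater ?f n T z))\<^sup>2) \<partial>(\<Pi>\<^sub>M i\<in>{1..n}. \<mu>))"
    unfolding \<rho>_def by (intro nn_integral_sum meas) auto
  also have "\<dots> = (\<Sum>T | T \<subseteq> {..<N} \<and> card T = n. ennreal (fact n))"
    by (intro sum.cong refl nn_integral_slater sf orthonormal_on_subset[OF on])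
      (auto intro: finite_subset)
  also have "\<dots> = ennreal (real (N choose n) * fact n)"
    using n_subsets[of "{..<N}" n] by (simp add: ennreal_mult ennreal_of_nat_eq_real_of_nat)
  also have "real (N choose n) * fact n = fact N / fact (N - n)"
    using binomial_fact[OF \<open>n \<le> N\<close>, where 'a = real] by simp
  finally show "emeasure (correlation_measure \<mu> n N) (space (correlation_measure \<mu> n N)) =
      ennreal (fact N / fact (N - n))"
    unfolding space_correlation_measure unfolding c .
qed

end
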